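(* Let $\Gamma_v=(G,v)$ be a one-step game with player set $\mathcal{N}=\{1,\dots,N\}$ and $v\in\mathbb{R}^N$, let $\lambda\in[0,1]$, $p\in[0,1]^N$, and let $m\in\mathcal{N}$ be an arbitrary fixed player. Define $\hat p:=\hat p_{m,\lambda}(p):=\big(p^{-m},(1-\lambda)p^m+\lambda\big)$. Let $r_{max}:=\max\{|r_S^n| : n\in\mathcal{N},\ S\subseteq\mathcal{N}\}$ and $\delta_v:=\max\{\max_{n\in\mathcal{N}}|v^n|,\ r_{max}\}$, and let $\|\cdot\|$ be the maximum norm on $\mathbb{R}^N$. Then: 1. $\varrho(\hat p,\emptyset)=(1-\lambda)\,\varrho(p,\emptyset)$. 2. $\gamma_v(\hat p)=(1-\lambda)\,\gamma_v(p)+\lambda\,\gamma_v\big((p^{-m},1)\big)$. 3. $\|\gamma_v(\hat p)-\gamma_v(p)\|\le\lambda\,(r_{max}+\delta_v)$. 4. If $\eta\ge0$, $p$ is $\eta$-perfect in $\Gamma_v$ and $p^m\in(0,1]$, then $\hat p$ is $\tilde\eta$-perfect in $\Gamma_v$ with $\tilde\eta:=\max\big(2\lambda r_{max}+(1-\lambda)\eta,\ \eta\big)$.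
   Context: A quitting game is a tuple $G=(\mathcal{N},(r_S)_{\emptyset\subseteq S\subseteq\mathcal{N}})$, where $\mathcal{N}=\{1,\dots,N\}$ is a finite set of players and $r_S=(r_S^1,\dots,r_S^N)^T\in\mathbb{R}^N$ is the payoff vector when exactly the players in $S$ quit, with $r_\emptyset=(0,\dots,0)^T$. For $v=(v^1,\dots,v^N)^T\in\mathbb{R}^N$, the one-step game $\Gamma_v=(G,v)$ is the one-stage game in which each player chooses continue (action $0$) or quit (action $1$); the payoff vector is $v$ if nobody quits and $r_S$ if $S\ne\emptyset$ is the set of quitting players. A strategy profile in $\Gamma_v$ is a vector $p=(p^1,\dots,p^N)^T\in[0,1]^N$, where $p^n$ is the probability that player $n$ quits (players act independently). For $S\subseteq\mathcal{N}$ put $\varrho(p,S):=\prod_{n\in S}p^n\prod_{m\in\mathcal{N}\setminus S}(1-p^m)$. The expected payoff is $\gamma_v(p)=(\gamma_v^1(p),\dots,\gamma_v^N(p))^T:=\varrho(p,\emptyset)\,v+\sum_{S\subseteq\mathcal{N}}\varrho(p,S)\,r_S$. For $b\in[0,1]$, $(p^{-n},b)$ denotes the profile obtained from $p$ by replacing the $n$-th component by $b$. For $\varepsilon\ge0$, an action $b\in\{0,1\}$ of player $n$ is an $\varepsilon$-best reply for $p^{-n}$ if $\gamma_v^n((p^{-n},b))\ge\max_{\tilde b\in\{0,1\}}\gamma_v^n((p^{-n},\tilde b))-\varepsilon$. Let $supp(x)=\{0\}$ if $x=0$, $\{0,1\}$ if $x\in(0,1)$, $\{1\}$ if $x=1$.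 $p$ is $\varepsilon$-perfect in $\Gamma_v$ if for every $n\in\mathcal{N}$ every action $b\in supp(p^n)$ is an $\varepsilon$-best reply for $p^{-n}$. *)

theory Defs
  imports "HOL-Analysis.Analysis"
begin

text \<open>
  The players are the elements of a finite type \<open>'n\<close>, so coalitions have type \<open>'n set\<close> and
  payoff vectors and strategy profiles have type \<open>real ^ 'n\<close>. A quitting game is given by
  its payoff function \<open>r\<close>, and a one-step game by \<open>r\<close> and the continuation payoff \<open>v\<close>.
\<close>

definition quitting_game :: "('n::finite set \<Rightarrow> real ^ 'n) \<Rightarrow> bool" where
  "quitting_game r \<longleftrightarrow> r {} = 0"

definition profiles :: "(real ^ 'n::finite) set" where
  "profiles = {p. \<forall>n. p $ n \<in> {0..1}}"

definition quit_prob :: "real ^ 'n::finite \<Rightarrow> 'n set \<Rightarrow> real" where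
  "quit_prob p S = (\<Prod>n\<in>S. p $ n) * (\<Prod>m\<in>UNIV - S. 1 - p $ m)"

text \<open>The sum ranges over all coalitions; its term at \<open>{}\<close> vanishes in a quitting game.\<close>

definition payoff ::
    "('n::finite set \<Rightarrow> real ^ 'n) \<Rightarrow> real ^ 'n \<Rightarrow> real ^ 'n \<Rightarrow> real ^ 'n" where
  "payoff r v p = quit_prob p {} *\<^sub>R v + (\<Sum>S\<in>UNIV. quit_prob p S *\<^sub>R r S)"

text \<open>\<open>replace p n b\<close> is the profile written $(p^{-n}, b)$.\<close>

definition replace :: "real ^ 'n::finite \<Rightarrow> 'n \<Rightarrow> real \<Rightarrow> real ^ 'n" where
  "replace p n b = (\<chi> i. if i = n then b else p $ i)"

text \<open>Actions are the reals \<open>0\<close> (continue) and \<open>1\<close> (quit), identified with pure strategies.\<close>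

definition best_reply ::
    "('n::finite set \<Rightarrow> real ^ 'n) \<Rightarrow> real ^ 'n \<Rightarrow> real \<Rightarrow> real ^ 'n \<Rightarrow> 'n \<Rightarrow> real \<Rightarrow> bool" where
  "best_reply r v \<epsilon> p n b \<longleftrightarrow>
     b \<in> {0, 1} \<and>
     payoff r v (replace p n b) $ n
       \<ge> Max ((\<lambda>b'. payoff r v (replace p n b') $ n) ` {0, 1}) - \<epsilon>"

text \<open>Only meaningful for arguments in the unit interval.\<close>

definition action_supp :: "real \<Rightarrow> real set" where
  "action_supp x = (if x = 0 then {0} else if x = 1 then {1} else {0, 1})"

definition perfect ::
    "('n::finite set \<Rightarrow> real ^ 'n) \<Rightarrow> real ^ 'n \<Rightarrow> real \<Rightarrow> real ^ 'n \<Rightarrow> bool" where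
  "perfect r v \<epsilon> p \<longleftrightarrow>
     p \<in> profiles \<and> (\<forall>n. \<forall>b\<in>action_supp (p $ n). best_reply r v \<epsilon> p n b)"

definition hat_profile :: "'n::finite \<Rightarrow> real \<Rightarrow> real ^ 'n \<Rightarrow> real ^ 'n" where
  "hat_profile m lam p = replace p m ((1 - lam) * p $ m + lam)"

definition r_max :: "('n::finite set \<Rightarrow> real ^ 'n) \<Rightarrow> real" where
  "r_max r = Max {\<bar>r S $ n\<bar> |n S. True}"

definition delta :: "('n::finite set \<Rightarrow> real ^ 'n) \<Rightarrow> real ^ 'n \<Rightarrow> real" where
  "delta r v = max (Max {\<bar>v $ n\<bar> |n. True}) (r_max r)"

end

theory Submission
  imports Defs
begin

text \<open>
  Each probability \<open>quit_prob p S\<close> is affine in the single coordinate \<open>p $ m\<close>, hence so is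
  \<open>payoff r v\<close>. Replacing \<open>p $ m\<close> by its convex combination with \<open>1\<close> therefore mixes the two
  payoffs, and the remaining claims follow since a payoff is an average over coalitions, in which
  the continuation payoff \<open>v\<close> has weight zero as soon as one player quits surely. For perfectness,
  player \<open>m\<close> faces unchanged opponents, while the payoff of any other player for each action
  is a mixture, with weights \<open>1 - lam\<close> and \<open>lam\<close>, of the old payoff and one bounded by \<open>r_max\<close>.
\<close>

lemma replace_nth [simp]: "replace p n b $ i = (if i = n then b else p $ i)"
  by (simp add: replace_def)

lemma replace_same [simp]: "replace p n (p $ n) = p"
  by (simp add: vec_eq_iff)

lemma replace_replace [simp]: "replace (replace p n b) n c = replace p n c"
  by (simp add: vec_eq_iff)

lemma replace_commute: "n \<noteq> m \<Longrightarrow> replace (replace p n b) m c = replace (replace p m c) n b"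
  by (simp add: vec_eq_iff)

lemma replace_in_profiles: "p \<in> profiles \<Longrightarrow> b \<in> {0..1} \<Longrightarrow> replace p n b \<in> profiles"
  by (simp add: profiles_def)

lemma quit_prob_nonneg: "p \<in> profiles \<Longrightarrow> 0 \<le> quit_prob p S"
  unfolding quit_prob_def profiles_def by (auto intro!: mult_nonneg_nonneg prod_nonneg)

text \<open>Expanding the product of the factors \<open>p $ n + (1 - p $ n)\<close>, each equal to
  1, gives one summand per coalition.\<close>

lemma sum_quit_prob: "(\<Sum>S\<in>UNIV. quit_prob p S) = 1"
  using prod_add[of UNIV "\<lambda>n. p $ n" "\<lambda>n. 1 - p $ n"]
  by (simp add: quit_prob_def)

text \<open>Splits off the factor of player \<open>m\<close>. The remaining products do not involve
  \<open>b\<close>, so affinity in \<open>b\<close> can be read off.\<close>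

lemma quit_prob_replace:
  "quit_prob (replace p m b) S =
    (if m \<in> S then b else 1 - b) * ((\<Prod>n\<in>S - {m}. p $ n) * (\<Prod>n\<in>UNIV - S - {m}. 1 - p $ n))"
proof (cases "m \<in> S")
  case True
  then have "(\<Prod>n\<in>S. replace p m b $ n) = b * (\<Prod>n\<in>S - {m}. p $ n)"
    by (simp add: prod.remove[of S m])
  moreover have "(\<Prod>n\<in>UNIV - S. 1 - replace p m b $ n) = (\<Prod>n\<in>UNIV - S - {m}. 1 - p $ n)"
    using True by (intro prod.cong) auto
  ultimately show ?thesis
    using True by (simp add: quit_prob_def)
next
  case False
  then have "(\<Prod>n\<in>UNIV - S. 1 - replace p m b $ n) = (1 - b) * (\<Prod>n\<in>UNIV - S - {m}. 1 - p $ n)"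
    by (simp add: prod.remove[of "UNIV - S" m])
  moreover have "(\<Prod>n\<in>S. replace p m b $ n) = (\<Prod>n\<in>S - {m}. p $ n)"
    using False by (intro prod.cong) auto
  ultimately show ?thesis
    using False by (simp add: quit_prob_def)
qed

lemma quit_prob_replace_affine:
  "quit_prob (replace p m ((1 - t) * b + t * c)) S =
    (1 - t) * quit_prob (replace p m b) S + t * quit_prob (replace p m c) S"
  by (simp add: quit_prob_replace algebra_simps)

lemma payoff_replace_affine:
  "payoff r v (replace p m ((1 - t) * b + t * c)) =
    (1 - t) *\<^sub>R payoff r v (replace p m b) + t *\<^sub>R payoff r v (replace p m c)"
  unfolding payoff_def quit_prob_replace_affine
  by (simp only: scaleR_add_left scaleR_add_right sum.distrib scaleR_sum_right scaleR_scaleR ac_simps)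

lemma quit_prob_hat_profile:
  "quit_prob (hat_profile m lam p) S = (1 - lam) * quit_prob p S + lam * quit_prob (replace p m 1) S"
  using quit_prob_replace_affine[of p m lam "p $ m" 1 S] by (simp add: hat_profile_def)

lemma payoff_hat_profile:
  "payoff r v (hat_profile m lam p) = (1 - lam) *\<^sub>R payoff r v p + lam *\<^sub>R payoff r v (replace p m 1)"
  using payoff_replace_affine[of r v p m lam "p $ m" 1] by (simp add: hat_profile_def)

text \<open>Player \<open>m\<close> contributes the factor \<open>1 - 1\<close>. This removes the
  \<open>lam\<close> term from the probability that nobody quits and makes \<open>v\<close> drop out
  of \<open>payoff r v (replace p m 1)\<close>.\<close>

lemma quit_prob_sure_quit [simp]: "quit_prob (replace p m 1) {} = 0"
  by (simp add: quit_prob_replace)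

text \<open>The disjunction on \<open>v\<close> lets one averaging argument serve two bounds:
  \<open>delta r v\<close> for arbitrary profiles, and \<open>r_max r\<close> for profiles in which
  somebody quits surely.\<close>

lemma abs_payoff_le:
  assumes r: "quitting_game r" and p: "p \<in> profiles"
    and v: "quit_prob p {} = 0 \<or> \<bar>v $ n\<bar> \<le> B"
    and B: "\<And>S. \<bar>r S $ n\<bar> \<le> B"
  shows "\<bar>payoff r v p $ n\<bar> \<le> B"
proof -
  \<comment> \<open>Since \<open>r {} = 0\<close>, the separate term for \<open>v\<close> can be
    absorbed as the value at \<open>{}\<close>, so the payoff becomes a single weighted
    average.\<close>
  have "payoff r v p $ n = (\<Sum>S\<in>UNIV. quit_prob p S * (r({} := v)) S $ n)"
    using r by (simp add: payoff_def quitting_game_def sum.remove[of UNIV "{}"])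
  also have "\<bar>\<dots>\<bar> \<le> (\<Sum>S\<in>UNIV. quit_prob p S * B)"
  proof (intro order_trans[OF sum_abs] sum_mono)
    fix S
    show "\<bar>quit_prob p S * (r({} := v)) S $ n\<bar> \<le> quit_prob p S * B"
      using v B[of S] quit_prob_nonneg[OF p, of S] by (cases "S = {}") (auto simp: abs_mult mult_left_mono)
  qed
  also have "\<dots> = B"
    by (simp add: sum_quit_prob flip: sum_distrib_right)
  finally show ?thesis .
qed

lemma abs_le_r_max: "\<bar>r S $ n\<bar> \<le> r_max r"
proof -
  have "{\<bar>r S $ n\<bar> |n S. True} = (\<lambda>(n, S). \<bar>r S $ n\<bar>) ` UNIV"
    by auto
  then have "finite {\<bar>r S $ n\<bar> |n S. True}"
    by simp
  then show ?thesis
    unfolding r_max_def by (auto intro: Max_ge)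
qed

lemma r_max_le_delta: "r_max r \<le> delta r v"
  by (simp add: delta_def)

lemma abs_le_delta: "\<bar>v $ n\<bar> \<le> delta r v"
proof -
  have "{\<bar>v $ n\<bar> |n. True} = range (\<lambda>n. \<bar>v $ n\<bar>)"
    by auto
  then have "\<bar>v $ n\<bar> \<le> Max {\<bar>v $ n\<bar> |n. True}"
    by simp
  then show ?thesis
    by (simp add: delta_def)
qed

lemma abs_payoff_le_delta:
  assumes "quitting_game r" "p \<in> profiles"
  shows "\<bar>payoff r v p $ n\<bar> \<le> delta r v"
  using assms abs_le_delta abs_le_r_max r_max_le_delta by (blast intro: abs_payoff_le order_trans)

lemma abs_payoff_sure_quit_le:
  assumes "quitting_game r" "p \<in> profiles"
  shows "\<bar>payoff r v (replace p m 1) $ n\<bar> \<le> r_max r"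
  using assms by (auto intro!: abs_payoff_le abs_le_r_max replace_in_profiles)

lemma best_reply_iff:
  "best_reply r v \<epsilon> p n b \<longleftrightarrow> b \<in> {0, 1} \<and>
    (\<forall>b'\<in>{0, 1}. payoff r v (replace p n b') $ n - \<epsilon> \<le> payoff r v (replace p n b) $ n)"
  unfolding best_reply_def by auto

lemma best_reply_mono: "best_reply r v \<epsilon> p n b \<Longrightarrow> \<epsilon> \<le> \<epsilon>' \<Longrightarrow> best_reply r v \<epsilon>' p n b"
  unfolding best_reply_def by auto

lemma infnorm_le_iff: "infnorm (x :: real ^ 'n) \<le> B \<longleftrightarrow> (\<forall>n. \<bar>x $ n\<bar> \<le> B)"
proof
  show "\<forall>n. \<bar>x $ n\<bar> \<le> B" if "infnorm x \<le> B"
    using that component_le_infnorm_cart order_trans by blast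
  show "infnorm x \<le> B" if "\<forall>n. \<bar>x $ n\<bar> \<le> B"
    using that unfolding infnorm_cart by (intro cSup_least) auto
qed

lemma infnorm_payoff_hat_profile_diff:
  assumes "quitting_game r" "p \<in> profiles" "0 \<le> lam"
  shows "infnorm (payoff r v (hat_profile m lam p) - payoff r v p) \<le> lam * (r_max r + delta r v)"
  unfolding infnorm_le_iff
proof
  fix n
  \<comment> \<open>Only the \<open>lam\<close> part of the mixture survives the subtraction. Of the
    two payoffs left, the one with a sure quitter is bounded by \<open>r_max r\<close>, the other by
    \<open>delta r v\<close>.\<close>
  have "(payoff r v (hat_profile m lam p) - payoff r v p) $ n
      = lam * (payoff r v (replace p m 1) $ n - payoff r v p $ n)"
    by (simp add: payoff_hat_profile algebra_simps)
  moreover have "\<bar>payoff r v (replace p m 1) $ n - payoff r v p $ n\<bar> \<le> r_max r + delta r v"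
    using abs_payoff_sure_quit_le[OF assms(1,2), of v m n] abs_payoff_le_delta[OF assms(1,2), of v n]
    by linarith
  ultimately show "\<bar>(payoff r v (hat_profile m lam p) - payoff r v p) $ n\<bar> \<le> lam * (r_max r + delta r v)"
    using \<open>0 \<le> lam\<close> by (simp add: abs_mult mult_left_mono)
qed

lemma hat_profile_in_profiles:
  assumes "p \<in> profiles" "lam \<in> {0..1}"
  shows "hat_profile m lam p \<in> profiles"
proof -
  have "(1 - lam) * p $ m + lam * 1 \<in> {0..1}"
    using assms convexD[OF convex_real_interval(5), of "p $ m" 0 1 1 "1 - lam" lam]
    by (simp add: profiles_def)
  then show ?thesis
    using assms(1) by (simp add: hat_profile_def replace_in_profiles)
qed

text \<open>A deviation gains at most \<eta> on the part of weight \<open>1 - lam\<close>. On the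
  part of weight \<open>lam\<close> both payoffs lie between \<open>- r_max r\<close> and
  \<open>r_max r\<close>, so it gains at most \<open>2 * r_max r\<close>.\<close>

lemma best_reply_hat_profile_other:
  assumes r: "quitting_game r" and lam: "lam \<in> {0..1}" and p: "p \<in> profiles" and "n \<noteq> m"
    and b: "best_reply r v \<eta> p n b"
  shows "best_reply r v (2 * lam * r_max r + (1 - lam) * \<eta>) (hat_profile m lam p) n b"
proof -
  have mix: "payoff r v (replace (hat_profile m lam p) n a) $ n
      = (1 - lam) * payoff r v (replace p n a) $ n
        + lam * payoff r v (replace (replace p n a) m 1) $ n" for a
  proof -
    \<comment> \<open>The changes concern different coordinates, so player \<open>n\<close> can
      deviate first and the mixture formula then applies to the deviated profile.\<close>
    have "replace (hat_profile m lam p) n a = hat_profile m lam (replace p n a)"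
      using \<open>n \<noteq> m\<close> by (simp add: hat_profile_def replace_commute)
    then show ?thesis
      by (simp add: payoff_hat_profile)
  qed
  have "payoff r v (replace (hat_profile m lam p) n a) $ n - (2 * lam * r_max r + (1 - lam) * \<eta>)
      \<le> payoff r v (replace (hat_profile m lam p) n b) $ n" if a: "a \<in> {0, 1}" for a
  proof -
    have bound: "\<bar>payoff r v (replace (replace p n c) m 1) $ n\<bar> \<le> r_max r" if "c \<in> {0, 1}" for c
      using that p r by (intro abs_payoff_sure_quit_le replace_in_profiles) auto
    have "b \<in> {0, 1}"
      using b by (simp add: best_reply_iff)
    then have "payoff r v (replace (replace p n a) m 1) $ n - 2 * r_max r
        \<le> payoff r v (replace (replace p n b) m 1) $ n"
      using bound[of a] bound[of b] a by linarith
    then have "lam * (payoff r v (replace (replace p n a) m 1) $ n - 2 * r_max r)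
        \<le> lam * payoff r v (replace (replace p n b) m 1) $ n"
      using lam by (simp add: mult_left_mono)
    moreover have "(1 - lam) * (payoff r v (replace p n a) $ n - \<eta>)
        \<le> (1 - lam) * payoff r v (replace p n b) $ n"
      using b a lam by (intro mult_left_mono) (auto simp: best_reply_iff)
    ultimately show ?thesis
      unfolding mix by (simp add: algebra_simps)
  qed
  then show ?thesis
    using b by (simp add: best_reply_iff)
qed

text \<open>Fixing an action of player \<open>m\<close> overwrites the only coordinate in which the
  two profiles differ.\<close>

lemma best_reply_hat_profile_same:
  "best_reply r v \<eta> (hat_profile m lam p) m b \<longleftrightarrow> best_reply r v \<eta> p m b"
  by (simp add: best_reply_def hat_profile_def)

text \<open>As \<open>p $ m\<close> is positive, quitting is already in its support. Continuing
  cannot be added either, because the value 1 is fixed by mixing with 1.\<close>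

lemma action_supp_hat_profile:
  assumes "lam \<in> {0..1}" "p $ m \<in> {0<..1}"
  shows "action_supp (hat_profile m lam p $ m) \<subseteq> action_supp (p $ m)"
proof -
  have "(1 - lam) * p $ m + lam \<noteq> 0"
  proof (cases "lam = 0")
    case False
    then have "0 < (1 - lam) * p $ m + lam"
      using assms by (intro add_nonneg_pos) auto
    then show ?thesis by simp
  qed (use assms in simp)
  then show ?thesis
    using assms by (auto simp: action_supp_def hat_profile_def)
qed

text \<open>Player \<open>m\<close> keeps the error \<eta>, while all others get the mixed error.
  Either of the two can be the larger, hence the maximum.\<close>

lemma perfect_hat_profile:
  assumes r: "quitting_game r" and lam: "lam \<in> {0..1}"
    and perf: "perfect r v \<eta> p" and pm: "p $ m \<in> {0<..1}"
  shows "perfect r v (max (2 * lam * r_max r + (1 - lam) * \<eta>) \<eta>) (hat_profile m lam p)"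
proof -
  have p: "p \<in> profiles"
    and reply: "\<And>n b. b \<in> action_supp (p $ n) \<Longrightarrow> best_reply r v \<eta> p n b"
    using perf by (auto simp: perfect_def)
  have "best_reply r v (max (2 * lam * r_max r + (1 - lam) * \<eta>) \<eta>) (hat_profile m lam p) n b"
    if b: "b \<in> action_supp (hat_profile m lam p $ n)" for n b
  proof (cases "n = m")
    case True
    then have "best_reply r v \<eta> (hat_profile m lam p) n b"
      using b reply action_supp_hat_profile[where p = p and m = m, OF lam pm]
      by (auto simp: best_reply_hat_profile_same)
    then show ?thesis
      by (rule best_reply_mono) simp
  next
    case False
    then have "best_reply r v \<eta> p n b"
      using b reply by (simp add: hat_profile_def)
    from best_reply_hat_profile_other[OF r lam p False this] show ?thesis
      by (rule best_reply_mono) simp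
  qed
  then show ?thesis
    using hat_profile_in_profiles[OF p lam] by (simp add: perfect_def)
qed

theorem theorem3p1:
  fixes r :: "'n::finite set \<Rightarrow> real ^ 'n"
    and v p :: "real ^ 'n"
    and m :: 'n
    and lam :: real
  assumes "quitting_game r"
    and "lam \<in> {0..1}"
    and "p \<in> profiles"
  shows "quit_prob (hat_profile m lam p) {} = (1 - lam) * quit_prob p {}
    \<and> payoff r v (hat_profile m lam p)
        = (1 - lam) *\<^sub>R payoff r v p + lam *\<^sub>R payoff r v (replace p m 1)
    \<and> infnorm (payoff r v (hat_profile m lam p) - payoff r v p) \<le> lam * (r_max r + delta r v)
    \<and> (\<forall>\<eta>\<ge>0. perfect r v \<eta> p \<longrightarrow> p $ m \<in> {0<..1} \<longrightarrow>
          perfect r v (max (2 * lam * r_max r + (1 - lam) * \<eta>) \<eta>) (hat_profile m lam p))"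
  using assms
  by (auto simp: quit_prob_hat_profile
      intro: payoff_hat_profile infnorm_payoff_hat_profile_diff perfect_hat_profile)

end
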